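(* Let $C\subset\mathbb{R}^n$ be a closed convex set and let $f:\mathbb{R}^n\to\mathbb{R}$ be continuously differentiable. Assume that there is $L>0$ with $\|\nabla f(x)-\nabla f(y)\|\le L\|x-y\|$ for all $x,y\in C$, and that $\nabla f(x)\in \mathrm{int}(C_\infty)^*$ for all $x\in C$. Let $(x^k)_{k\in\mathbb{N}}\subset C$ and $(p^k)_{k\in\mathbb{N}}\subset C$ be infinite sequences generated by the Frank--Wolfe algorithm for minimizing $f$ over $C$ (with the step size using this $L$, as described in the context), started from a point $x^0\in C$, and assume that $\lim_{k\to\infty}x^k=x^*$. Set $$\sigma:=\sup_{k\ge 0}\|p^k-x^k\|,\qquad \gamma:=\sup_{k\ge 0}\|\nabla f(x^k)\|,\qquad \Gamma:=\min\left\{\frac{1}{2\gamma\sigma},\ \frac{1}{2L\sigma^2}\right\},$$ (under these assumptions $0<\sigma<\infty$, $0<\gamma<\infty$ and $\Gamma>0$), and $f^*:=\inf_{x\in C}f(x)$. Then: (i) If $f$ is convex on $C$, then $f(x^k)-f^*\le \Gamma^{-1}/k$ for all $k=1,2,\ldots$. (ii) If $f$ is $M$-strongly convex on $C$ for some $M>0$, then $\|x^k-x^*\|\le \sqrt{2/(\Gamma M)}\,/\sqrt{k}$ for all $k=1,2,\ldots$.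
   Context: $\|\cdot\|$ is the Euclidean norm on $\mathbb{R}^n$. For a closed convex set $C\subset\mathbb{R}^n$, the asymptotic cone is $C_\infty:=\{d\in\mathbb{R}^n:\ x+td\in C\ \ \forall x\in C,\ \forall t\ge 0\}$ (equivalently, the set of all $d=\lim_k t_k x^k$ with $x^k\in C$, $t_k>0$, $t_k\to 0$), and $\mathrm{int}(C_\infty)^*:=\{x\in\mathbb{R}^n:\ x^Ty>0\ \ \forall y\in C_\infty\setminus\{0\}\}$ is the interior of the positive dual cone of $C_\infty$. A function $f$ is $M$-strongly convex on $C$ if $f(tx+(1-t)y)\le tf(x)+(1-t)f(y)-\frac{1}{2}Mt(1-t)\|y-x\|^2$ for all $t\in[0,1]$ and $x,y\in C$; it is convex on $C$ if this holds with $M=0$. Frank--Wolfe algorithm: choose $x^0\in C$. Given $x^k\in C$, choose any $p^k\in\operatorname{argmin}_{p\in C}\nabla f(x^k)^T(p-x^k)$ and set $v_k^*:=\nabla f(x^k)^T(p^k-x^k)$. If $v_k^*=0$, stop. Otherwise set $\lambda_k:=\min\{1,\ |v_k^*|/(L\|p^k-x^k\|^2)\}$ and $x^{k+1}:=x^k+\lambda_k(p^k-x^k)$. Under the stated assumptions the argmin is nonempty for every $x^k\in C$. The generated sequences are infinite when the algorithm never stops, i.e. $v_k^*\ne 0$ for all $k$. *)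

theory Defs
  imports "HOL-Analysis.Analysis"
begin

definition asymptotic_cone :: "'a::real_vector set \<Rightarrow> 'a set" where
  "asymptotic_cone C = {d. \<forall>x\<in>C. \<forall>t\<ge>0. x + t *\<^sub>R d \<in> C}"

text \<open>For a closed convex cone \<open>K\<close> in a Euclidean space this is the interior of the
  positive dual cone of \<open>K\<close>.\<close>

definition int_pos_dual_cone :: "'a::real_inner set \<Rightarrow> 'a set" where
  "int_pos_dual_cone K = {x. \<forall>y\<in>K - {0}. 0 < x \<bullet> y}"

definition strongly_convex_on :: "real \<Rightarrow> 'a::real_normed_vector set \<Rightarrow> ('a \<Rightarrow> real) \<Rightarrow> bool" where
  "strongly_convex_on M C f \<longleftrightarrow>
    (\<forall>t\<in>{0..1}. \<forall>x\<in>C. \<forall>y\<in>C.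
      f (t *\<^sub>R x + (1 - t) *\<^sub>R y)
        \<le> t * f x + (1 - t) * f y - 1/2 * M * t * (1 - t) * (norm (y - x))\<^sup>2)"

lemma strongly_convex_on_0_iff_convex_on:
  assumes "convex C"
  shows "strongly_convex_on 0 C f \<longleftrightarrow> convex_on C f"
proof
  assume f: "strongly_convex_on 0 C f"
  show "convex_on C f"
    unfolding convex_on_def
  proof (intro conjI ballI allI impI)
    fix x y and u v :: real
    assume "x \<in> C" "y \<in> C" "0 \<le> u" "0 \<le> v" "u + v = 1"
    moreover from this have "v = 1 - u" "u \<in> {0..1}" by auto
    ultimately show "f (u *\<^sub>R x + v *\<^sub>R y) \<le> u * f x + v * f y"
      using f unfolding strongly_convex_on_def by auto
  qed (rule assms)
next
  assume "convex_on C f"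
  then show "strongly_convex_on 0 C f"
    unfolding strongly_convex_on_def convex_on_def by auto
qed

text \<open>The step length, with \<open>v\<close> the optimal value of the linearized subproblem and \<open>d\<close> the
  direction \<open>p - x\<close>.\<close>

definition fw_step :: "real \<Rightarrow> real \<Rightarrow> 'a::real_normed_vector \<Rightarrow> real" where
  "fw_step L v d = min 1 (\<bar>v\<bar> / (L * (norm d)\<^sup>2))"

text \<open>The sequences \<open>x\<close> and \<open>p\<close> form an infinite (never stopping) run of the Frank--Wolfe
  algorithm over \<open>C\<close>; \<open>g\<close> is the gradient of the objective. The choice of \<open>p k\<close> among the
  minimizers is arbitrary. All iterates lie in \<open>C\<close> when \<open>C\<close> is convex and \<open>L > 0\<close>.\<close>

definition frank_wolfe_run ::
  "'a::real_inner set \<Rightarrow> ('a \<Rightarrow> 'a) \<Rightarrow> real \<Rightarrow> (nat \<Rightarrow> 'a) \<Rightarrow> (nat \<Rightarrow> 'a) \<Rightarrow> bool" where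
  "frank_wolfe_run C g L x p \<longleftrightarrow>
    x 0 \<in> C \<and>
    (\<forall>k. let v = g (x k) \<bullet> (p k - x k) in
      is_arg_min (\<lambda>q. g (x k) \<bullet> (q - x k)) (\<lambda>q. q \<in> C) (p k) \<and>
      v \<noteq> 0 \<and>
      x (Suc k) = x k + fw_step L v (p k - x k) *\<^sub>R (p k - x k))"

end

theory Submission
  imports Defs
begin

text \<open>The descent lemma gives \<open>f (x (k+1)) \<le> f (x k) - \<Gamma> v\<^sup>2\<close> with \<open>v\<close> the optimal value of the linearized
  subproblem, and convexity gives \<open>f (x k) - f* \<le> \<bar>v\<bar>\<close>. Hence the gap \<open>\<delta>\<close> satisfies
  \<open>\<delta> (k+1) \<le> \<delta> k - \<Gamma> (\<delta> k)\<^sup>2\<close>, so \<open>1/\<delta>\<close> grows by at least \<open>\<Gamma>\<close> in each step. Strong convexity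
  converts the gap into a distance, since the limit point is then a minimizer. The points \<open>p k\<close> stay
  bounded: otherwise a limit \<open>d\<close> of their normalizations would be a nonzero asymptotic direction of
  \<open>C\<close> with \<open>\<nabla>f(x*) \<bullet> d \<le> 0\<close>.\<close>

section \<open>Descent along segments\<close>

lemma GDERIV_along_line:
  assumes "GDERIV f (x + t *\<^sub>R d) :> D"
  shows "((\<lambda>t. f (x + t *\<^sub>R d)) has_real_derivative D \<bullet> d) (at t)"
proof -
  have "(f has_derivative (\<lambda>h. h \<bullet> D)) (at (x + t *\<^sub>R d))"
    using assms by (simp add: gderiv_def)
  moreover have "((\<lambda>t. x + t *\<^sub>R d) has_derivative (\<lambda>h. h *\<^sub>R d)) (at t)"
    by (auto intro!: derivative_eq_intros)
  ultimately have "((\<lambda>t. f (x + t *\<^sub>R d)) has_derivative (\<lambda>h. (h *\<^sub>R d) \<bullet> D)) (at t)"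
    by (rule has_derivative_compose[rotated])
  moreover have "(\<lambda>h. (h *\<^sub>R d) \<bullet> D) = (*) (D \<bullet> d)"
    by (auto simp: inner_commute)
  ultimately show ?thesis
    by (simp add: has_field_derivative_def)
qed

text \<open>Subtracting the quadratic model from \<open>f\<close> along the segment leaves a
  nonincreasing function: Cauchy-Schwarz and the Lipschitz bound make its derivative nonpositive.
  That bound is available on \<open>C\<close> only, and convexity keeps the segment inside
  \<open>C\<close>.\<close>

lemma descent_inequality:
  fixes x d :: "'a::real_inner"
  assumes deriv: "\<And>z. GDERIV f z :> g z"
    and "convex C" "x \<in> C" "x + d \<in> C"
    and lip: "\<And>y z. y \<in> C \<Longrightarrow> z \<in> C \<Longrightarrow> norm (g y - g z) \<le> L * norm (y - z)"
    and t: "0 \<le> t" "t \<le> 1"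
  shows "f (x + t *\<^sub>R d) \<le> f x + t * (g x \<bullet> d) + L * t\<^sup>2 * (norm d)\<^sup>2 / 2"
proof -
  define h where "h s = f (x + s *\<^sub>R d) - s * (g x \<bullet> d) - L * s\<^sup>2 * (norm d)\<^sup>2 / 2" for s
  have h': "(h has_real_derivative g (x + s *\<^sub>R d) \<bullet> d - g x \<bullet> d - L * s * (norm d)\<^sup>2) (at s)" for s
    unfolding h_def
    by (rule DERIV_cong, rule DERIV_diff[OF DERIV_diff[OF GDERIV_along_line[OF deriv]]])
      (auto intro!: derivative_eq_intros)
  have "h t \<le> h 0"
  proof (rule DERIV_nonpos_imp_nonincreasing[OF t(1)])
    fix s assume s: "0 \<le> s" "s \<le> t"
    have "x + s *\<^sub>R d = (1 - s) *\<^sub>R x + s *\<^sub>R (x + d)"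
      by (simp add: algebra_simps)
    then have "x + s *\<^sub>R d \<in> C"
      using s t assms by (auto intro: convexD)
    then have "norm (g (x + s *\<^sub>R d) - g x) \<le> L * (s * norm d)"
      using lip[of "x + s *\<^sub>R d" x] \<open>x \<in> C\<close> s by simp
    then have "(g (x + s *\<^sub>R d) - g x) \<bullet> d \<le> L * (s * norm d) * norm d"
      by (rule order_trans[OF norm_cauchy_schwarz mult_right_mono]) simp
    then have "g (x + s *\<^sub>R d) \<bullet> d - g x \<bullet> d - L * s * (norm d)\<^sup>2 \<le> 0"
      by (simp add: inner_diff_left power2_eq_square algebra_simps)
    then show "\<exists>y. (h has_real_derivative y) (at s) \<and> y \<le> 0"
      using h' by blast
  qed
  then show ?thesis by (simp add: h_def)
qed

section \<open>Consequences of convexity and strong convexity\<close>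

text \<open>Convexity bounds the difference quotient along the segment by \<open>f y - f x\<close>
  for every \<open>t\<close> strictly between 0 and 1, and the quotients tend to the directional
  derivative. The limit is taken from the right because negative \<open>t\<close> may leave
  \<open>C\<close>.\<close>

lemma convex_on_above_gradient:
  assumes "GDERIV f x :> D" and cvx: "convex_on C f" and "x \<in> C" "y \<in> C"
  shows "f x + D \<bullet> (y - x) \<le> f y"
proof -
  have "((\<lambda>t. f (x + t *\<^sub>R (y - x))) has_real_derivative D \<bullet> (y - x)) (at 0)"
    using assms by (intro GDERIV_along_line) simp
  then have "((\<lambda>t. (f (x + t *\<^sub>R (y - x)) - f x) / t) \<longlongrightarrow> D \<bullet> (y - x)) (at 0)"
    by (simp add: DERIV_def)
  then have "((\<lambda>t. (f (x + t *\<^sub>R (y - x)) - f x) / t) \<longlongrightarrow> D \<bullet> (y - x)) (at_right 0)"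
    by (rule tendsto_mono[OF at_le[OF subset_UNIV]])
  moreover have "eventually (\<lambda>t. (f (x + t *\<^sub>R (y - x)) - f x) / t \<le> f y - f x) (at_right 0)"
  proof -
    have "eventually (\<lambda>t::real. t \<in> {0<..<1}) (at_right 0)"
      by (rule eventually_at_right_real) simp
    then show ?thesis
    proof eventually_elim
      case (elim t)
      have "f (x + t *\<^sub>R (y - x)) = f ((1 - t) *\<^sub>R x + t *\<^sub>R y)"
        by (simp add: algebra_simps)
      also have "\<dots> \<le> (1 - t) * f x + t * f y"
        using elim assms by (intro convex_onD[OF cvx]) auto
      finally have "f (x + t *\<^sub>R (y - x)) - f x \<le> (f y - f x) * t"
        by (simp add: left_diff_distrib right_diff_distrib mult.commute)
      then show ?case
        using elim by (simp only: pos_divide_le_eq greaterThanLessThan_iff)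
    qed
  qed
  ultimately have "D \<bullet> (y - x) \<le> f y - f x"
    by (rule tendsto_upperbound) simp
  then show ?thesis by simp
qed

lemma strongly_convex_on_mono:
  assumes "strongly_convex_on M C f" "N \<le> M"
  shows "strongly_convex_on N C f"
  unfolding strongly_convex_on_def
proof (intro ballI)
  fix t x y assume "t \<in> {0..1::real}" "x \<in> C" "y \<in> C"
  moreover from this have "N * (t * (1 - t) * (norm (y - x))\<^sup>2) \<le> M * (t * (1 - t) * (norm (y - x))\<^sup>2)"
    using \<open>N \<le> M\<close> by (intro mult_right_mono) auto
  ultimately show "f (t *\<^sub>R x + (1 - t) *\<^sub>R y)
      \<le> t * f x + (1 - t) * f y - 1/2 * N * t * (1 - t) * (norm (y - x))\<^sup>2"
    using assms(1) unfolding strongly_convex_on_def by (force simp: mult.assoc)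
qed

text \<open>The minimal value is compared with the value at the point a fraction \<open>t\<close> of
  the way from \<open>z\<close> to \<open>y\<close>. Dividing by \<open>t\<close> leaves the claim
  with an extra factor \<open>1 - t\<close>, which tends to 1 as \<open>t\<close> tends to
  0.\<close>

lemma strongly_convex_on_quadratic_growth:
  assumes "convex C" and sc: "strongly_convex_on M C f"
    and "z \<in> C" "y \<in> C" and min: "\<And>w. w \<in> C \<Longrightarrow> f z \<le> f w"
  shows "M / 2 * (norm (y - z))\<^sup>2 \<le> f y - f z"
proof -
  have "((\<lambda>t. M / 2 * (1 - t) * (norm (y - z))\<^sup>2) \<longlongrightarrow> M / 2 * (1 - 0) * (norm (y - z))\<^sup>2) (at_right 0)"
    by (intro tendsto_intros)
  moreover have "eventually (\<lambda>t. M / 2 * (1 - t) * (norm (y - z))\<^sup>2 \<le> f y - f z) (at_right 0)"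
  proof -
    have "eventually (\<lambda>t::real. t \<in> {0<..<1}) (at_right 0)"
      by (rule eventually_at_right_real) simp
    then show ?thesis
    proof eventually_elim
      case (elim t)
      have "f z \<le> f (t *\<^sub>R y + (1 - t) *\<^sub>R z)"
        using elim assms by (intro min convexD) auto
      also have "\<dots> \<le> t * f y + (1 - t) * f z - 1/2 * M * t * (1 - t) * (norm (z - y))\<^sup>2"
        using sc elim \<open>z \<in> C\<close> \<open>y \<in> C\<close> unfolding strongly_convex_on_def by auto
      finally have "t * (M / 2 * (1 - t) * (norm (y - z))\<^sup>2) \<le> t * (f y - f z)"
        by (simp add: algebra_simps norm_minus_commute)
      then show ?case using elim by simp
    qed
  qed
  ultimately have "M / 2 * (1 - 0) * (norm (y - z))\<^sup>2 \<le> f y - f z"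
    by (rule tendsto_upperbound) simp
  then show ?thesis by simp
qed

section \<open>Asymptotic directions and bounded minimizers\<close>

text \<open>The point \<open>x + s *\<^sub>R d\<close> is the limit of combinations of
  \<open>x\<close> and \<open>q k\<close> with weight \<open>s * t k\<close> on \<open>q k\<close>;
  these are convex combinations as soon as \<open>s * t k < 1\<close>, so closedness
  applies.\<close>

lemma asymptotic_cone_limitI:
  fixes C :: "'a::real_normed_vector set"
  assumes "closed C" "convex C" and q: "\<And>k. q k \<in> C"
    and lim: "(\<lambda>k. t k *\<^sub>R q k) \<longlonglongrightarrow> d" and t0: "t \<longlonglongrightarrow> 0" and tpos: "\<And>k. 0 < t k"
  shows "d \<in> asymptotic_cone C"
  unfolding asymptotic_cone_def
proof (intro CollectI ballI allI impI)
  fix x and s :: real assume x: "x \<in> C" and s: "0 \<le> s"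
  have "(\<lambda>k. (1 - s * t k) *\<^sub>R x + s *\<^sub>R (t k *\<^sub>R q k)) \<longlonglongrightarrow> (1 - s * 0) *\<^sub>R x + s *\<^sub>R d"
    by (intro tendsto_intros lim t0)
  then have conv: "(\<lambda>k. (1 - s * t k) *\<^sub>R x + (s * t k) *\<^sub>R q k) \<longlonglongrightarrow> x + s *\<^sub>R d"
    by simp
  have "(\<lambda>k. s * t k) \<longlonglongrightarrow> s * 0"
    by (intro tendsto_intros t0)
  then have "eventually (\<lambda>k. s * t k < 1) sequentially"
    by (rule order_tendstoD) simp
  then have "eventually (\<lambda>k. (1 - s * t k) *\<^sub>R x + (s * t k) *\<^sub>R q k \<in> C) sequentially"
    by eventually_elim
      (use assms x s tpos in \<open>auto intro!: convexD mult_nonneg_nonneg less_imp_le[OF tpos]\<close>)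
  then show "x + s *\<^sub>R d \<in> C"
    by (rule Lim_in_closed_set[OF \<open>closed C\<close> _ sequentially_bot conv])
qed

text \<open>Applied to the gradients at the iterates, this makes the supremum of the direction norms
  finite. The costs may vary with the index because only their limit \<open>c0\<close> is paired
  with the escape direction.\<close>

lemma bounded_linear_minimizers:
  fixes C :: "'a::euclidean_space set"
  assumes "closed C" "convex C"
    and c: "c \<longlonglongrightarrow> c0" and dual: "c0 \<in> int_pos_dual_cone (asymptotic_cone C)"
    and p: "\<And>k. p k \<in> C" and min: "\<And>k q. q \<in> C \<Longrightarrow> c k \<bullet> p k \<le> c k \<bullet> q"
  shows "bounded (range p)"
proof (rule ccontr)
  assume "\<not> bounded (range p)"
  \<comment> \<open>Discarding finitely many points keeps the range unbounded. Demanding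
    \<open>k \<ge> n\<close> lets the costs at the chosen indices still tend to \<open>c0\<close>;
    the summand 1 makes the chosen points nonzero even for \<open>n = 0\<close>.\<close>
  have "\<exists>k\<ge>n. real n + 1 < norm (p k)" for n
  proof (rule ccontr)
    assume "\<not> (\<exists>k\<ge>n. real n + 1 < norm (p k))"
    then have "p ` {n..} \<subseteq> cball 0 (real n + 1)"
      by (auto simp: not_less)
    then have "bounded (p ` {n..})"
      using bounded_subset by blast
    moreover have "bounded (p ` {..<n})"
      by (intro finite_imp_bounded) simp
    ultimately have "bounded (p ` {..<n} \<union> p ` {n..})" by simp
    moreover have "{..<n} \<union> {n..} = UNIV" by auto
    ultimately show False
      using \<open>\<not> bounded (range p)\<close> by (simp add: image_Un[symmetric])
  qed
  then obtain r where r_ge: "\<And>n. n \<le> r n" and r: "\<And>n. real n + 1 < norm (p (r n))" by metis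
  have pos: "0 < norm (p (r n))" for n using r[of n] by linarith
  \<comment> \<open>The normalized points lie on the compact unit sphere, so a subsequence converges
    to a unit vector, which is in particular nonzero.\<close>
  have "range (\<lambda>n. sgn (p (r n))) \<subseteq> sphere 0 1"
    using pos by (auto simp: norm_sgn)
  moreover have "compact (sphere (0::'a) 1)" by simp
  ultimately obtain d s where d: "d \<in> sphere 0 1" and s: "strict_mono s"
    and lim: "((\<lambda>n. sgn (p (r n))) \<circ> s) \<longlonglongrightarrow> d"
    unfolding compact_def by (metis range_subsetD)
  define u where "u n = r (s n)" for n
  have u: "real n + 1 < norm (p (u n))" for n
    using r[of "s n"] seq_suble[OF s, of n] by (simp add: u_def)
  have inf: "filterlim (\<lambda>n. norm (p (u n))) at_top sequentially"
    by (rule filterlim_at_top_mono[OF filterlim_real_sequentially])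
      (intro always_eventually allI, use u in \<open>metis less_eq_real_def less_add_one order_less_trans\<close>)
  have t0: "(\<lambda>n. inverse (norm (p (u n)))) \<longlonglongrightarrow> 0"
    by (rule tendsto_inverse_0_at_top[OF inf])
  have limu: "(\<lambda>n. inverse (norm (p (u n))) *\<^sub>R p (u n)) \<longlonglongrightarrow> d"
    using lim by (simp add: o_def u_def sgn_div_norm)
  have "d \<in> asymptotic_cone C"
    by (rule asymptotic_cone_limitI[OF assms(1,2) _ limu t0]) (use p pos u_def in auto)
  with d dual have "0 < c0 \<bullet> d"
    unfolding int_pos_dual_cone_def by auto
  moreover have "c0 \<bullet> d \<le> 0"
  proof -
    have "n \<le> u n" for n
      using r_ge[of "s n"] seq_suble[OF s, of n] by (simp add: u_def)
    then have "filterlim u sequentially sequentially"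
      by (intro filterlim_at_top_mono[OF filterlim_ident]) auto
    then have cu: "(\<lambda>n. c (u n)) \<longlonglongrightarrow> c0"
      by (rule filterlim_compose[OF c])
    \<comment> \<open>Optimality is tested against the fixed competitor \<open>p 0\<close>: after
      division by the growing norm its cost vanishes in the limit, while the minimizer's cost tends
      to \<open>c0 \<bullet> d\<close>.\<close>
    have "(\<lambda>n. inverse (norm (p (u n))) * (c (u n) \<bullet> p 0)) \<longlonglongrightarrow> 0 * (c0 \<bullet> p 0)"
      by (intro tendsto_intros t0 cu)
    then have "c0 \<bullet> d \<le> 0 * (c0 \<bullet> p 0)"
    proof (rule LIMSEQ_le[rotated])
      show "(\<lambda>n. c (u n) \<bullet> (inverse (norm (p (u n))) *\<^sub>R p (u n))) \<longlonglongrightarrow> c0 \<bullet> d"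
        by (intro tendsto_intros limu cu)
      show "\<exists>N. \<forall>n\<ge>N. c (u n) \<bullet> (inverse (norm (p (u n))) *\<^sub>R p (u n))
          \<le> inverse (norm (p (u n))) * (c (u n) \<bullet> p 0)"
        using min[OF p] by (auto intro!: mult_left_mono)
    qed
    then show ?thesis by simp
  qed
  ultimately show False by simp
qed

section \<open>The quadratic recursion for the gap\<close>

text \<open>Since \<open>\<delta>\<close> is nonincreasing, one factor of the square may be lowered
  to \<open>\<delta> (Suc k)\<close>. Dividing by \<open>\<delta> k * \<delta> (Suc k)\<close> then
  shows that the reciprocals grow by at least \<open>c\<close> per step.\<close>

lemma inverse_bound_of_quadratic_decrease:
  fixes \<delta> :: "nat \<Rightarrow> real"
  assumes c: "0 < c" and pos: "\<And>k. 0 < \<delta> k"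
    and dec: "\<And>k. \<delta> (Suc k) \<le> \<delta> k - c * (\<delta> k)\<^sup>2" and "1 \<le> k"
  shows "\<delta> k \<le> inverse c / real k"
proof -
  have "c * real k \<le> inverse (\<delta> k)"
  proof (induction k)
    case 0
    show ?case using pos[of 0] by simp
  next
    case (Suc k)
    have "\<delta> (Suc k) \<le> \<delta> k"
      using dec[of k] c by (smt (verit) mult_nonneg_nonneg zero_le_power2)
    then have "c * (\<delta> k * \<delta> (Suc k)) \<le> c * (\<delta> k)\<^sup>2"
      using c pos[of k] by (simp add: power2_eq_square)
    then have "c * (\<delta> k * \<delta> (Suc k)) \<le> \<delta> k - \<delta> (Suc k)"
      using dec[of k] by linarith
    then have "c \<le> inverse (\<delta> (Suc k)) - inverse (\<delta> k)"
      using pos[of k] pos[of "Suc k"] by (simp add: field_simps)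
    then show ?case using Suc by (simp add: algebra_simps)
  qed
  moreover have "0 < c * real k" using c \<open>1 \<le> k\<close> by simp
  ultimately have "inverse (inverse (\<delta> k)) \<le> inverse (c * real k)"
    by (intro le_imp_inverse_le)
  then show ?thesis by (simp add: divide_inverse)
qed

section \<open>Feasibility and decrease of a single step\<close>

lemma frank_wolfe_run_mem:
  assumes "convex C" "0 < L" and run: "frank_wolfe_run C g L x p"
  shows "p k \<in> C" "x k \<in> C"
proof -
  show p: "p k \<in> C" for k
    using run by (auto simp: frank_wolfe_run_def Let_def is_arg_min_def)
  show "x k \<in> C"
  proof (induction k)
    case 0
    show ?case using run by (simp add: frank_wolfe_run_def)
  next
    case (Suc k)
    define l where "l = fw_step L (g (x k) \<bullet> (p k - x k)) (p k - x k)"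
    have "0 \<le> l" "l \<le> 1" using \<open>0 < L\<close> by (auto simp: l_def fw_step_def)
    moreover have "x (Suc k) = (1 - l) *\<^sub>R x k + l *\<^sub>R p k"
      using run by (simp add: frank_wolfe_run_def Let_def l_def algebra_simps)
    ultimately show ?case using Suc p \<open>convex C\<close> by (auto intro: convexD)
  qed
qed

text \<open>Here \<open>F\<close> stands for the objective along the segment, \<open>D\<close> for a
  bound on the direction norms and \<open>c\<close> for a bound on the gradient norms. The two
  entries of the minimum serve the full step and the shortened step respectively.\<close>

lemma fw_step_decrease:
  assumes "0 < L" "v < 0" "0 < D" "norm d \<le> D" "\<bar>v\<bar> \<le> c * D" "0 < c" "d \<noteq> 0"
    and desc: "\<And>t. 0 \<le> t \<Longrightarrow> t \<le> 1 \<Longrightarrow> F t \<le> F 0 + t * v + L * t\<^sup>2 * (norm d)\<^sup>2 / 2"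
  shows "F (fw_step L v d) \<le> F 0 - min (1 / (2 * c * D)) (1 / (2 * L * D\<^sup>2)) * v\<^sup>2"
proof -
  define G where "G = min (1 / (2 * c * D)) (1 / (2 * L * D\<^sup>2))"
  define N where "N = L * (norm d)\<^sup>2"
  have N: "0 < N" using assms by (simp add: N_def)
  show ?thesis
  proof (cases "N \<le> \<bar>v\<bar>")
    case True
    \<comment> \<open>The quadratic term costs at most half of the linear gain, so a full step gains
      at least \<open>\<bar>v\<bar> / 2\<close>; the bound \<open>\<bar>v\<bar> \<le> c * D\<close>
      turns this into a multiple of \<open>v\<^sup>2\<close>.\<close>
    then have "fw_step L v d = 1"
      using N by (simp add: fw_step_def N_def[symmetric] min_def)
    then have "F (fw_step L v d) \<le> F 0 + v + N / 2"
      using desc[of 1] by (simp add: N_def)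
    also have "\<dots> \<le> F 0 - \<bar>v\<bar> / 2" using True \<open>v < 0\<close> by simp
    also have "\<dots> \<le> F 0 - 1 / (2 * c * D) * v\<^sup>2"
    proof -
      have "v\<^sup>2 \<le> \<bar>v\<bar> * (c * D)"
        using mult_left_mono[OF \<open>\<bar>v\<bar> \<le> c * D\<close> abs_ge_zero[of v]]
        by (simp add: power2_eq_square)
      then show ?thesis using assms by (simp add: field_simps)
    qed
    also have "\<dots> \<le> F 0 - G * v\<^sup>2"
      unfolding G_def by (intro diff_left_mono mult_right_mono) auto
    finally show ?thesis by (simp add: G_def)
  next
    case False
    then have "\<bar>v\<bar> / N \<le> 1"
      using N by simp
    \<comment> \<open>This step length is the minimizer of the quadratic model
      \<open>t * v + N * t\<^sup>2 / 2\<close>, whose minimal value is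
      \<open>- v\<^sup>2 / (2 * N)\<close>.\<close>
    then have eq: "fw_step L v d = - v / N"
      using \<open>v < 0\<close> by (simp add: fw_step_def N_def[symmetric] min_absorb2)
    have "F (- v / N) \<le> F 0 + (- v / N) * v + (- v / N)\<^sup>2 * N / 2"
      using desc[of "- v / N"] N False \<open>v < 0\<close> by (simp add: N_def field_simps)
    also have "\<dots> = F 0 - 1 / (2 * N) * v\<^sup>2"
      using N by (simp add: field_simps power2_eq_square)
    also have "\<dots> \<le> F 0 - 1 / (2 * L * D\<^sup>2) * v\<^sup>2"
    proof -
      have "N \<le> L * D\<^sup>2"
        unfolding N_def using assms by (intro mult_left_mono power_mono) auto
      then have "1 / (2 * L * D\<^sup>2) \<le> 1 / (2 * N)"
        using N by (intro frac_le) auto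
      then show ?thesis by (intro diff_left_mono mult_right_mono) auto
    qed
    also have "\<dots> \<le> F 0 - G * v\<^sup>2"
      unfolding G_def by (intro diff_left_mono mult_right_mono) auto
    finally show ?thesis by (simp add: G_def eq)
  qed
qed

section \<open>Convergence rates along the run\<close>

theorem theorem3p7:
  fixes C :: "(real ^ 'n) set"
    and f :: "real ^ 'n \<Rightarrow> real"
    and g :: "real ^ 'n \<Rightarrow> real ^ 'n"
    and L \<sigma> \<gamma> \<Gamma> :: real
    and x p :: "nat \<Rightarrow> real ^ 'n"
    and xs :: "real ^ 'n"
  assumes "closed C" and "convex C"
    and "\<And>z. GDERIV f z :> g z" and "continuous_on UNIV g"
    and "L > 0"
    and "\<And>y z. y \<in> C \<Longrightarrow> z \<in> C \<Longrightarrow> norm (g y - g z) \<le> L * norm (y - z)"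
    and "\<And>z. z \<in> C \<Longrightarrow> g z \<in> int_pos_dual_cone (asymptotic_cone C)"
    and "frank_wolfe_run C g L x p"
    and "x \<longlonglongrightarrow> xs"
    and "\<sigma> = (SUP k. norm (p k - x k))"
    and "\<gamma> = (SUP k. norm (g (x k)))"
    and "\<Gamma> = min (1 / (2 * \<gamma> * \<sigma>)) (1 / (2 * L * \<sigma>\<^sup>2))"
  shows "bdd_above (range (\<lambda>k. norm (p k - x k))) \<and> 0 < \<sigma> \<and>
    bdd_above (range (\<lambda>k. norm (g (x k)))) \<and> 0 < \<gamma> \<and> 0 < \<Gamma> \<and>
    (convex_on C f \<longrightarrow>
      bdd_below (f ` C) \<and>
      (\<forall>k\<ge>1. f (x k) - (INF z\<in>C. f z) \<le> inverse \<Gamma> / real k)) \<and>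
    (\<forall>M>0. strongly_convex_on M C f \<longrightarrow>
      (\<forall>k\<ge>1. norm (x k - xs) \<le> sqrt (2 / (\<Gamma> * M)) / sqrt (real k)))"
proof -
  have mem: "p k \<in> C" "x k \<in> C" for k
    using frank_wolfe_run_mem[OF assms(2,5,8)] by auto
  define v where "v k = g (x k) \<bullet> (p k - x k)" for k
  have step: "x (Suc k) = x k + fw_step L (v k) (p k - x k) *\<^sub>R (p k - x k)"
    and v_ne: "v k \<noteq> 0"
    and v_min: "q \<in> C \<Longrightarrow> v k \<le> g (x k) \<bullet> (q - x k)" for k q
    using assms(8) by (auto simp: frank_wolfe_run_def Let_def v_def is_arg_min_linorder)
  \<comment> \<open>The current iterate is itself a competitor in the subproblem, with value
    0.\<close>
  have v_neg: "v k < 0" for k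
    using v_min[OF mem(2), of k k] v_ne[of k] by simp
  have xs: "xs \<in> C"
    by (rule closed_sequentially[OF assms(1) mem(2) assms(9)])
  have g_lim: "(\<lambda>k. g (x k)) \<longlonglongrightarrow> g xs"
    using assms(4,9) by (auto simp: continuous_on_eq_continuous_at intro: isCont_tendsto_compose)
  have "bounded (range p)"
    by (rule bounded_linear_minimizers[OF assms(1,2) g_lim assms(7)[OF xs] mem(1)])
      (use v_min in \<open>simp add: v_def inner_diff_right\<close>)
  moreover have "bounded (range x)"
    using assms(9) convergent_imp_bounded by blast
  ultimately have "bounded (range (\<lambda>k. p k - x k))"
    by (rule bounded_minus_comp)
  then have bdd_d: "bdd_above (range (\<lambda>k. norm (p k - x k)))"
    by (simp add: bdd_above_norm image_image[symmetric, of norm "\<lambda>k. p k - x k"])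
  have "bounded (range (\<lambda>k. g (x k)))"
    using g_lim convergent_imp_bounded by blast
  then have bdd_g: "bdd_above (range (\<lambda>k. norm (g (x k))))"
    by (simp add: bdd_above_norm image_image[symmetric, of norm "\<lambda>k. g (x k)"])
  have le_\<sigma>: "norm (p k - x k) \<le> \<sigma>" for k
    unfolding assms(10) by (rule cSUP_upper[OF UNIV_I bdd_d])
  have le_\<gamma>: "norm (g (x k)) \<le> \<gamma>" for k
    unfolding assms(11) by (rule cSUP_upper[OF UNIV_I bdd_g])
  have d_ne: "p k - x k \<noteq> 0" for k
    using v_ne[of k] by (auto simp: v_def)
  have \<sigma>: "0 < \<sigma>"
    using le_\<sigma>[of 0] d_ne[of 0] by (smt (verit) zero_less_norm_iff)
  have "g (x 0) \<noteq> 0" using v_ne[of 0] by (auto simp: v_def)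
  then have \<gamma>: "0 < \<gamma>"
    using le_\<gamma>[of 0] by (smt (verit) zero_less_norm_iff)
  have \<Gamma>: "0 < \<Gamma>"
    using \<sigma> \<gamma> \<open>L > 0\<close> by (simp add: assms(12))
  have decrease: "f (x (Suc k)) \<le> f (x k) - \<Gamma> * (v k)\<^sup>2" for k
  proof -
    have "\<bar>v k\<bar> \<le> norm (g (x k)) * norm (p k - x k)"
      unfolding v_def by (rule Cauchy_Schwarz_ineq2)
    also have "\<dots> \<le> \<gamma> * \<sigma>"
      using le_\<sigma> le_\<gamma> \<gamma> by (intro mult_mono) auto
    finally have "\<bar>v k\<bar> \<le> \<gamma> * \<sigma>" .
    \<comment> \<open>With \<open>c\<close> and \<open>D\<close> taken as \<open>\<gamma>\<close>
      and \<open>\<sigma>\<close>, the minimum in the one-step bound is exactly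
      \<open>\<Gamma>\<close>.\<close>
    from fw_step_decrease[OF \<open>L > 0\<close> v_neg \<sigma> le_\<sigma> this \<gamma> d_ne,
        of "\<lambda>t. f (x k + t *\<^sub>R (p k - x k))"]
    show ?thesis
      using descent_inequality[OF assms(3,2) mem(2) _ assms(6), of k "p k - x k"] mem(1)[of k]
      by (simp add: step v_def assms(12))
  qed
  have below: "f (x k) + v k \<le> f y" if "convex_on C f" "y \<in> C" for k y
    using convex_on_above_gradient[OF assms(3) that(1) mem(2) that(2), of k] v_min[OF that(2), of k]
    by linarith
  \<comment> \<open>The linearization at the single iterate \<open>x 0\<close> already bounds
    \<open>f\<close> from below by \<open>f (x 0) + v 0\<close>.\<close>
  have bdd: "bdd_below (f ` C)" if "convex_on C f"
    using below[OF that, of _ 0] by (auto intro!: bdd_belowI)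
  have rate: "f (x k) - (INF z\<in>C. f z) \<le> inverse \<Gamma> / real k" if cvx: "convex_on C f" and "1 \<le> k" for k
  proof (rule inverse_bound_of_quadratic_decrease[OF \<Gamma> _ _ \<open>1 \<le> k\<close>])
    fix k
    have inf_le: "(INF z\<in>C. f z) \<le> f (x j)" for j
      by (rule cINF_lower[OF bdd[OF cvx] mem(2)])
    \<comment> \<open>As the run never stops, the decrease is strict, so no iterate attains the
      infimum; this provides the positive gap required for taking reciprocals.\<close>
    have "f (x (Suc k)) < f (x k)"
      using decrease[of k] v_ne[of k] \<Gamma> by (smt (verit) mult_pos_pos zero_less_power2)
    with inf_le[of "Suc k"] show pos: "0 < f (x k) - (INF z\<in>C. f z)" by linarith
    \<comment> \<open>The lower bound is uniform over \<open>C\<close>, so it passes to the infimum: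
      the gap is at most \<open>- v k\<close>, and both sides are nonnegative when squared.\<close>
    have "f (x k) + v k \<le> (INF z\<in>C. f z)"
      using mem(1) below[OF cvx] by (intro cINF_greatest) auto
    then have "(f (x k) - (INF z\<in>C. f z))\<^sup>2 \<le> (- v k)\<^sup>2"
      using pos by (intro power_mono) auto
    then have "\<Gamma> * (f (x k) - (INF z\<in>C. f z))\<^sup>2 \<le> \<Gamma> * (v k)\<^sup>2"
      using \<Gamma> by simp
    then show "f (x (Suc k)) - (INF z\<in>C. f z)
        \<le> f (x k) - (INF z\<in>C. f z) - \<Gamma> * (f (x k) - (INF z\<in>C. f z))\<^sup>2"
      using decrease[of k] by linarith
  qed
  have dist: "norm (x k - xs) \<le> sqrt (2 / (\<Gamma> * M)) / sqrt (real k)"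
    if "0 < M" and sc: "strongly_convex_on M C f" and "1 \<le> k" for M k
  proof -
    have cvx: "convex_on C f"
      using strongly_convex_on_mono[OF sc, of 0] \<open>0 < M\<close>
      by (simp add: strongly_convex_on_0_iff_convex_on[OF assms(2)])
    \<comment> \<open>The rate from the convex case forces \<open>f (x k)\<close> down to the
      infimum, and continuity then makes the limit \<open>xs\<close> a minimizer, as quadratic
      growth requires.\<close>
    have "isCont f xs"
      using assms(3) GDERIV_DERIV_compose gderiv_def has_derivative_continuous by blast
    then have "(\<lambda>k. f (x k)) \<longlonglongrightarrow> f xs"
      using assms(9) by (rule isCont_tendsto_compose)
    moreover have "(\<lambda>k. (INF z\<in>C. f z) + inverse \<Gamma> / real k) \<longlonglongrightarrow> (INF z\<in>C. f z) + 0"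
      by (intro tendsto_intros lim_const_over_n)
    moreover have "\<forall>k\<ge>1. f (x k) \<le> (INF z\<in>C. f z) + inverse \<Gamma> / real k"
      using rate[OF cvx] by (simp add: algebra_simps)
    ultimately have "f xs \<le> (INF z\<in>C. f z) + 0"
      using LIMSEQ_le by blast
    then have xs_le: "f xs \<le> (INF z\<in>C. f z)" by simp
    then have "f xs \<le> f w" if "w \<in> C" for w
      using cINF_lower[OF bdd[OF cvx] that] by linarith
    then have "M / 2 * (norm (x k - xs))\<^sup>2 \<le> f (x k) - f xs"
      by (rule strongly_convex_on_quadratic_growth[OF assms(2) sc xs mem(2)])
    also have "f xs = (INF z\<in>C. f z)"
      using xs_le cINF_lower[OF bdd[OF cvx] xs] by linarith
    also have "f (x k) - (INF z\<in>C. f z) \<le> inverse \<Gamma> / real k"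
      by (rule rate[OF cvx \<open>1 \<le> k\<close>])
    finally have "(norm (x k - xs))\<^sup>2 \<le> 2 / (\<Gamma> * M) / real k"
      using \<open>0 < M\<close> \<Gamma> \<open>1 \<le> k\<close> by (simp add: field_simps)
    then show ?thesis
      by (metis real_le_rsqrt real_sqrt_divide)
  qed
  show ?thesis
    by (intro conjI impI allI bdd_d bdd_g \<sigma> \<gamma> \<Gamma> bdd rate dist; assumption)
qed

end
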